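(* There exists a convex function $f:\mathbb{R}^d\to\mathbb{R}$ (for some dimension $d$) with Lipschitz gradient and Lipschitz Hessian such that, for any $\alpha>0$, the iMAML meta-objective $\varphi(x) := f(z(x))$ is nonsmooth, i.e. there is no finite $L$ for which $\varphi$ is $L$-smooth, where $z(x)$ is defined by $z(x)=x-\alpha\nabla f(z(x))$.
   Context: For convex differentiable $f$ and $\alpha>0$, the equation $z(x)=x-\alpha\nabla f(z(x))$ has a unique solution for every $x\in\mathbb{R}^d$, namely $z(x)=\operatorname{argmin}_{z\in\mathbb{R}^d}\{f(z)+\frac{1}{2\alpha}\|z-x\|^2\}$. A function $\varphi$ is called $L$-smooth if it is differentiable and its gradient is $L$-Lipschitz: $\|\nabla\varphi(x)-\nabla\varphi(y)\|\le L\|x-y\|$ for all $x,y$. *)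

theory Defs
  imports "HOL-Analysis.Analysis"
begin

text \<open>
  The dimension \<open>d\<close> is existentially quantified, so it cannot be a type. \<open>fsvec\<close> is the space of
  finitely supported real sequences with the Euclidean inner product, and \<open>\<real>\<^sup>d\<close> is its subspace
  \<open>Rd d\<close> of the vectors supported on \<open>{..<d}\<close>, with the Euclidean norm. (The library's norm on
  \<open>nat \<Rightarrow>\<^sub>0 real\<close> is the \<open>\<ell>\<^sup>1\<close> norm, hence the new type.) A function on \<open>\<real>\<^sup>d\<close> is a function on
  \<open>fsvec\<close> of which only the values on \<open>Rd d\<close> are used; derivatives are taken within \<open>Rd d\<close>.
\<close>

typedef fsvec = "{x :: nat \<Rightarrow> real. finite {i. x i \<noteq> 0}}"
  morphisms coord Abs_fsvec
  by (rule exI[of _ "\<lambda>_. 0"]) simp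

setup_lifting type_definition_fsvec

lemma finite_coord [simp]: "finite {i. coord x i \<noteq> 0}"
  using coord by auto

lemma fsvec_eqI: "(\<And>i. coord x i = coord y i) \<Longrightarrow> x = y"
  by transfer auto

instantiation fsvec :: real_vector
begin

lift_definition zero_fsvec :: fsvec is "\<lambda>_. 0" by simp

lift_definition plus_fsvec :: "fsvec \<Rightarrow> fsvec \<Rightarrow> fsvec" is "\<lambda>x y i. x i + y i"
  by (erule (1) finite_subset[OF _ finite_UnI, rotated]) auto

lift_definition uminus_fsvec :: "fsvec \<Rightarrow> fsvec" is "\<lambda>x i. - x i" by simp

lift_definition minus_fsvec :: "fsvec \<Rightarrow> fsvec \<Rightarrow> fsvec" is "\<lambda>x y i. x i - y i"
  by (erule (1) finite_subset[OF _ finite_UnI, rotated]) auto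

lift_definition scaleR_fsvec :: "real \<Rightarrow> fsvec \<Rightarrow> fsvec" is "\<lambda>c x i. c * x i"
  by (rule finite_subset) auto

instance
  by standard (transfer; simp add: algebra_simps fun_eq_iff)+

end

lemmas coord_simps [simp] =
  zero_fsvec.rep_eq plus_fsvec.rep_eq uminus_fsvec.rep_eq minus_fsvec.rep_eq scaleR_fsvec.rep_eq

definition inner_fsvec_raw :: "fsvec \<Rightarrow> fsvec \<Rightarrow> real"
  where "inner_fsvec_raw x y = (\<Sum>i | coord x i \<noteq> 0. coord x i * coord y i)"

lemma inner_fsvec_raw_superset:
  assumes "finite S" "{i. coord x i \<noteq> 0} \<subseteq> S"
  shows "inner_fsvec_raw x y = (\<Sum>i\<in>S. coord x i * coord y i)"
  unfolding inner_fsvec_raw_def using assms by (intro sum.mono_neutral_left) auto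

instantiation fsvec :: real_inner
begin

definition inner_fsvec :: "fsvec \<Rightarrow> fsvec \<Rightarrow> real"
  where "inner_fsvec = inner_fsvec_raw"

definition norm_fsvec :: "fsvec \<Rightarrow> real"
  where "norm_fsvec x = sqrt (inner x x)"

definition sgn_fsvec :: "fsvec \<Rightarrow> fsvec"
  where "sgn_fsvec x = x /\<^sub>R norm x"

definition dist_fsvec :: "fsvec \<Rightarrow> fsvec \<Rightarrow> real"
  where "dist_fsvec x y = norm (x - y)"

definition uniformity_fsvec :: "(fsvec \<times> fsvec) filter"
  where "uniformity_fsvec = (INF e\<in>{0<..}. principal {(x, y). dist x y < e})"

definition open_fsvec :: "fsvec set \<Rightarrow> bool"
  where "open_fsvec U \<longleftrightarrow> (\<forall>x\<in>U. \<forall>\<^sub>F (x', y) in uniformity. x' = x \<longrightarrow> y \<in> U)"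

instance
proof
  fix x y z :: fsvec and r :: real
  let ?S = "{i. coord x i \<noteq> 0} \<union> {i. coord y i \<noteq> 0}"
  show "inner x y = inner y x"
    unfolding inner_fsvec_def
    by (subst (1 2) inner_fsvec_raw_superset[of ?S]) (auto simp: mult.commute)
  show "inner (x + y) z = inner x z + inner y z"
    unfolding inner_fsvec_def
    by (subst (1 2 3) inner_fsvec_raw_superset[of ?S])
       (auto simp: sum.distrib[symmetric] algebra_simps)
  show "inner (r *\<^sub>R x) y = r * inner x y"
    unfolding inner_fsvec_def
    by (subst (1 2) inner_fsvec_raw_superset[of ?S])
       (auto simp: sum_distrib_left algebra_simps)
  show "0 \<le> inner x x"
    by (simp add: inner_fsvec_def inner_fsvec_raw_def sum_nonneg)
  show "inner x x = 0 \<longleftrightarrow> x = 0"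
  proof
    assume "inner x x = 0"
    then have "\<forall>i\<in>{i. coord x i \<noteq> 0}. coord x i * coord x i = 0"
      unfolding inner_fsvec_def inner_fsvec_raw_def by (subst (asm) sum_nonneg_eq_0_iff) auto
    then show "x = 0" by (intro fsvec_eqI) auto
  qed (simp add: inner_fsvec_def inner_fsvec_raw_def)
qed (simp_all add: norm_fsvec_def sgn_fsvec_def dist_fsvec_def uniformity_fsvec_def open_fsvec_def)

end

definition Rd :: "nat \<Rightarrow> fsvec set"
  where "Rd d = {x. \<forall>i\<ge>d. coord x i = 0}"

lemma inner_Rd: "x \<in> Rd d \<Longrightarrow> inner x y = (\<Sum>i<d. coord x i * coord y i)"
  unfolding inner_fsvec_def Rd_def
  by (rule inner_fsvec_raw_superset) (auto simp: not_le[symmetric])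

lemma norm_Rd: "x \<in> Rd d \<Longrightarrow> norm x = L2_set (coord x) {..<d}"
  by (simp add: norm_fsvec_def inner_Rd L2_set_def power2_eq_square)

lemma bij_betw_Rd: "bij_betw (\<lambda>x. restrict (coord x) {..<d}) (Rd d) ({..<d} \<rightarrow>\<^sub>E UNIV)"
proof (rule bij_betwI')
  fix x y assume "x \<in> Rd d" "y \<in> Rd d"
  then show "(restrict (coord x) {..<d} = restrict (coord y) {..<d}) = (x = y)"
    by (auto simp: Rd_def fun_eq_iff restrict_def not_le[symmetric] intro!: fsvec_eqI)
       (metis not_le)
next
  fix u :: "nat \<Rightarrow> real" assume u: "u \<in> {..<d} \<rightarrow>\<^sub>E UNIV"
  let ?v = "\<lambda>i. if i < d then u i else 0"
  have "finite {i. ?v i \<noteq> 0}" by (rule finite_subset[of _ "{..<d}"]) auto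
  then have c: "coord (Abs_fsvec ?v) = ?v" by (simp add: Abs_fsvec_inverse)
  show "\<exists>x\<in>Rd d. u = restrict (coord x) {..<d}"
    using u by (intro bexI[of _ "Abs_fsvec ?v"]) (auto simp: c Rd_def fun_eq_iff restrict_def PiE_def extensional_def)
qed auto

lemma subspace_Rd: "subspace (Rd d)"
  by (auto simp: subspace_def Rd_def)

text \<open>A derivative within a subspace is unique on that subspace.\<close>

lemma has_derivative_within_subspace_unique:
  fixes f :: "'a::real_normed_vector \<Rightarrow> 'b::real_normed_vector"
  assumes S: "subspace S" and x: "x \<in> S" and h: "h \<in> S"
    and A: "(f has_derivative A) (at x within S)" and B: "(f has_derivative B) (at x within S)"
  shows "A h = B h"
proof -
  let ?g = "\<lambda>t::real. x + t *\<^sub>R h"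
  have g: "(?g has_derivative (\<lambda>t. t *\<^sub>R h)) (at 0)"
    by (auto intro!: derivative_eq_intros)
  have sub: "range ?g \<subseteq> S"
    using S x h by (auto intro: subspace_add subspace_scale)
  have "((\<lambda>t. f (?g t)) has_derivative (\<lambda>t. C (t *\<^sub>R h))) (at 0)"
    if "(f has_derivative C) (at x within S)" for C
    using has_derivative_in_compose[OF g, of f C] has_derivative_subset[OF that sub] by simp
  from has_derivative_unique[OF this[OF A] this[OF B]] show ?thesis
    by (auto dest: fun_cong[of _ _ 1])
qed

definition gradient_within :: "'a::real_inner set \<Rightarrow> ('a \<Rightarrow> real) \<Rightarrow> 'a \<Rightarrow> 'a"
  where "gradient_within S f x =
    (THE g. g \<in> S \<and> (f has_derivative (\<lambda>h. inner g h)) (at x within S))"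

lemma gradient_within_eqI:
  assumes S: "subspace S" and x: "x \<in> S" and g: "g \<in> S"
    and D: "(f has_derivative (\<lambda>h. inner g h)) (at x within S)"
  shows "gradient_within S f x = g"
  unfolding gradient_within_def
proof (rule the_equality)
  fix g' assume g': "g' \<in> S \<and> (f has_derivative (\<lambda>h. inner g' h)) (at x within S)"
  have "g' - g \<in> S" using S g g' by (auto intro: subspace_diff)
  from has_derivative_within_subspace_unique[OF S x this conjunct2[OF g'] D]
  have "inner (g' - g) (g' - g) = 0" by (simp add: inner_diff_left)
  then show "g' = g" by simp
qed (use g D in auto)

definition L_smooth :: "'a::real_inner set \<Rightarrow> real \<Rightarrow> ('a \<Rightarrow> real) \<Rightarrow> bool"
  where "L_smooth S L f \<longleftrightarrow>
    f differentiable_on S \<and> L-lipschitz_on S (gradient_within S f)"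

definition hessian_within :: "'a::real_inner set \<Rightarrow> ('a \<Rightarrow> real) \<Rightarrow> 'a \<Rightarrow> 'a \<Rightarrow> 'a"
  where "hessian_within S f x = frechet_derivative (gradient_within S f) (at x within S)"

text \<open>
  The bound on \<open>norm (hessian_within S f x h - hessian_within S f y h)\<close> for all \<open>h \<in> S\<close> bounds the
  operator norm on \<open>S\<close> of the difference of the two Hessians. Only arguments \<open>h \<in> S\<close> matter,
  since the Frechet derivative within \<open>S\<close> is determined on \<open>S\<close> only.
\<close>

definition lipschitz_hessian :: "'a::real_inner set \<Rightarrow> real \<Rightarrow> ('a \<Rightarrow> real) \<Rightarrow> bool"
  where "lipschitz_hessian S M f \<longleftrightarrow>
    f differentiable_on S \<and> gradient_within S f differentiable_on S \<and> 0 \<le> M \<and>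
    (\<forall>x\<in>S. \<forall>y\<in>S. \<forall>h\<in>S.
      norm (hessian_within S f x h - hessian_within S f y h) \<le> M * dist x y * norm h)"

definition inner_solution :: "'a::real_inner set \<Rightarrow> ('a \<Rightarrow> real) \<Rightarrow> real \<Rightarrow> 'a \<Rightarrow> 'a"
  where "inner_solution S f \<alpha> x = (THE z. z \<in> S \<and> z = x - \<alpha> *\<^sub>R gradient_within S f z)"

definition imaml_objective :: "'a::real_inner set \<Rightarrow> ('a \<Rightarrow> real) \<Rightarrow> real \<Rightarrow> 'a \<Rightarrow> real"
  where "imaml_objective S f \<alpha> x = f (inner_solution S f \<alpha> x)"

end

theory Submission
  imports Defs
begin

text \<open>
  Dimension one suffices, with \<open>f(t) = t\<^sup>2/2 - cos t\<close>. Its derivative \<open>t + sin t\<close> is unbounded, while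
  its second derivative \<open>1 + cos t\<close> is nonnegative, bounded, Lipschitz, and oscillates forever between
  \<open>0\<close> and \<open>2\<close>. Differentiating \<open>\<phi>(z + \<alpha> f'(z)) = f(z)\<close> with respect to \<open>z\<close> gives
  \<open>\<phi>'(z + \<alpha> f'(z)) = f'(z) / (1 + \<alpha> f''(z))\<close>.
  The denominator is \<open>1\<close> at odd multiples of \<open>\<pi>\<close> and \<open>1 + 2\<alpha>\<close> at even ones. Between the points
  \<open>z = 2n\<pi>\<close> and \<open>z = (2n+1)\<pi>\<close> the argument \<open>x = z + \<alpha> f'(z) = (1 + \<alpha>) z\<close> moves by the
  constant \<open>(1 + \<alpha>) \<pi>\<close>, but the slope \<open>\<phi>'\<close> moves from \<open>2n\<pi> / (1 + 2\<alpha>)\<close> to \<open>(2n+1)\<pi>\<close>, a jump that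
  grows linearly in \<open>n\<close>. So \<open>\<phi>'\<close> is not Lipschitz.

  The map \<open>z \<mapsto> z + \<alpha> f'(z)\<close> is strictly increasing, hence injective, which identifies \<open>z\<close> as
  the solution of the inner problem at \<open>z + \<alpha> f'(z)\<close> (\<open>inner_solution_ridge\<close>). A smooth \<open>\<phi>\<close> is
  in particular differentiable, so the formula for \<open>\<phi>'\<close> is the chain rule along this map
  (\<open>gradient_along_reparametrization\<close>).
\<close>

section \<open>Calculus on the line spanned by a unit vector\<close>

text \<open>
  The real line sits inside the ambient space as the span of a unit vector \<open>e\<close>. A function \<open>F\<close> of one
  real variable becomes the ridge function \<open>\<lambda>v. F (inner e v)\<close>, and all derivatives within the line
  reduce to ordinary derivatives of \<open>F\<close>.
\<close>

locale unit_vector =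
  fixes e :: "'a::real_inner"
  assumes inner_self [simp]: "inner e e = 1"
begin

definition line :: "'a set"
  where "line = range (\<lambda>t::real. t *\<^sub>R e)"

lemma norm_unit [simp]: "norm e = 1"
  by (simp add: norm_eq_sqrt_inner)

lemma scaleR_mem_line [simp]: "t *\<^sub>R e \<in> line"
  unfolding line_def by (rule rangeI)

lemma scaleR_inner_line: "x \<in> line \<Longrightarrow> inner e x *\<^sub>R e = x"
  by (auto simp: line_def)

lemma subspace_line: "subspace line"
proof -
  have "line = span {e}" by (simp add: line_def span_singleton)
  then show ?thesis by simp
qed

lemma dist_scaleR_unit [simp]: "dist (s *\<^sub>R e) (t *\<^sub>R e) = \<bar>s - t\<bar>"
  by (simp add: dist_norm flip: scaleR_left_diff_distrib)

lemma abs_inner_diff_le_dist: "\<bar>inner e x - inner e y\<bar> \<le> dist x y"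
  using Cauchy_Schwarz_ineq2[of e "x - y"] by (simp add: inner_diff_right dist_norm)

text \<open>
  A derivative within the line is pinned down only on the line. Replacing \<open>f\<close> by its composition with
  the orthogonal projection onto the line changes nothing on the line and makes the derivative the
  inner product with a vector of the line.
\<close>

lemma gradient_on_line:
  assumes x: "x \<in> line" and D: "(f has_derivative D) (at x within line)"
  shows "gradient_within line f x = D e *\<^sub>R e"
proof (rule gradient_within_eqI[OF subspace_line x])
  let ?P = "\<lambda>v. inner e v *\<^sub>R e"
  have P: "(?P has_derivative ?P) (at x within line)"
    by (auto intro!: derivative_eq_intros)
  have "(f has_derivative D) (at (?P x) within ?P ` line)"
    unfolding scaleR_inner_line[OF x] by (rule has_derivative_subset[OF D]) auto
  from has_derivative_in_compose[OF P this]
  have "((\<lambda>v. f (?P v)) has_derivative (\<lambda>h. D (?P h))) (at x within line)" .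
  then have "(f has_derivative (\<lambda>h. D (?P h))) (at x within line)"
    by (rule has_derivative_transform[OF x, rotated]) (simp add: scaleR_inner_line)
  moreover have "(\<lambda>h. D (?P h)) = inner (D e *\<^sub>R e)"
    using linear_scale[OF has_derivative_linear[OF D]] by (simp add: fun_eq_iff)
  ultimately show "(f has_derivative inner (D e *\<^sub>R e)) (at x within line)"
    by (simp only:)
qed simp

lemma has_derivative_ridge:
  assumes "\<And>t. (F has_real_derivative F' t) (at t)"
  shows "((\<lambda>v. F (inner e v)) has_derivative (\<lambda>h. F' (inner e x) * inner e h)) (at x within S)"
proof -
  have "((\<lambda>v. inner e v) has_derivative (\<lambda>h. inner e h)) (at x within S)"
    by (auto intro!: derivative_eq_intros)
  from has_derivative_compose[OF this assms[unfolded has_field_derivative_def]]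
  show ?thesis .
qed

lemma gradient_ridge:
  assumes "\<And>t. (F has_real_derivative F' t) (at t)" and "x \<in> line"
  shows "gradient_within line (\<lambda>v. F (inner e v)) x = F' (inner e x) *\<^sub>R e"
  using gradient_on_line[OF assms(2) has_derivative_ridge[OF assms(1)]] by simp

lemma convex_on_ridge:
  assumes F: "convex_on UNIV F"
  shows "convex_on line (\<lambda>v. F (inner e v))"
  using convex_onD[OF F]
  by (auto intro!: convex_onI subspace_imp_convex[OF subspace_line] simp: inner_add_right)

lemma L_smooth_ridge:
  assumes F: "\<And>t. (F has_real_derivative F' t) (at t)" and L: "L-lipschitz_on UNIV F'"
  shows "L_smooth line L (\<lambda>v. F (inner e v))"
  unfolding L_smooth_def
proof
  show "(\<lambda>v. F (inner e v)) differentiable_on line"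
    unfolding differentiable_on_def differentiable_def using has_derivative_ridge[OF F] by blast
  show "L-lipschitz_on line (gradient_within line (\<lambda>v. F (inner e v)))"
  proof (rule lipschitz_onI)
    fix x y assume "x \<in> line" "y \<in> line"
    have "\<bar>F' (inner e x) - F' (inner e y)\<bar> \<le> L * \<bar>inner e x - inner e y\<bar>"
      using lipschitz_onD[OF L] by (simp add: dist_real_def)
    also have "\<dots> \<le> L * dist x y"
      using lipschitz_on_nonneg[OF L] abs_inner_diff_le_dist by (rule mult_left_mono[rotated])
    finally show "dist (gradient_within line (\<lambda>v. F (inner e v)) x)
        (gradient_within line (\<lambda>v. F (inner e v)) y) \<le> L * dist x y"
      by (simp add: gradient_ridge[OF F] \<open>x \<in> line\<close> \<open>y \<in> line\<close>)
  qed (rule lipschitz_on_nonneg[OF L])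
qed

lemma has_derivative_gradient_ridge:
  assumes F: "\<And>t. (F has_real_derivative F' t) (at t)"
    and F': "\<And>t. (F' has_real_derivative F'' t) (at t)" and x: "x \<in> line"
  shows "(gradient_within line (\<lambda>v. F (inner e v)) has_derivative
    (\<lambda>h. (F'' (inner e x) * inner e h) *\<^sub>R e)) (at x within line)"
  by (rule has_derivative_transform[OF x _ has_derivative_scaleR_left[OF has_derivative_ridge[OF F']]])
     (rule gradient_ridge[OF F])

lemma lipschitz_hessian_ridge:
  assumes F: "\<And>t. (F has_real_derivative F' t) (at t)"
    and F': "\<And>t. (F' has_real_derivative F'' t) (at t)"
    and M: "M-lipschitz_on UNIV F''"
  shows "lipschitz_hessian line M (\<lambda>v. F (inner e v))"
proof -
  let ?f = "\<lambda>v. F (inner e v)"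
  note D = has_derivative_gradient_ridge[OF F F']
  have H: "hessian_within line ?f x h = (F'' (inner e x) * inner e h) *\<^sub>R e"
    if x: "x \<in> line" and h: "h \<in> line" for x h
  proof -
    have "gradient_within line ?f differentiable (at x within line)"
      using D[OF x] by (auto simp: differentiable_def)
    then have "(gradient_within line ?f has_derivative hessian_within line ?f x) (at x within line)"
      unfolding hessian_within_def by (simp add: frechet_derivative_works)
    from has_derivative_within_subspace_unique[OF subspace_line x h this D[OF x]] show ?thesis .
  qed
  have "norm (hessian_within line ?f x h - hessian_within line ?f y h) \<le> M * dist x y * norm h"
    if "x \<in> line" "y \<in> line" "h \<in> line" for x y h
  proof -
    have "\<bar>F'' (inner e x) - F'' (inner e y)\<bar> \<le> M * \<bar>inner e x - inner e y\<bar>"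
      using lipschitz_onD[OF M] by (simp add: dist_real_def)
    also have "\<dots> \<le> M * dist x y"
      using lipschitz_on_nonneg[OF M] abs_inner_diff_le_dist by (rule mult_left_mono[rotated])
    finally have "\<bar>F'' (inner e x) - F'' (inner e y)\<bar> \<le> M * dist x y" .
    moreover have "\<bar>inner e h\<bar> \<le> norm h"
      using Cauchy_Schwarz_ineq2[of e h] by simp
    ultimately have "\<bar>F'' (inner e x) - F'' (inner e y)\<bar> * \<bar>inner e h\<bar> \<le> M * dist x y * norm h"
      by (intro mult_mono) (auto intro!: mult_nonneg_nonneg lipschitz_on_nonneg[OF M])
    moreover have "hessian_within line ?f x h - hessian_within line ?f y h
        = ((F'' (inner e x) - F'' (inner e y)) * inner e h) *\<^sub>R e"
      using that by (simp only: H left_diff_distrib scaleR_left_diff_distrib)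
    ultimately show ?thesis by (simp add: abs_mult)
  qed
  moreover have "?f differentiable_on line"
    unfolding differentiable_on_def differentiable_def using has_derivative_ridge[OF F] by blast
  moreover have "gradient_within line ?f differentiable_on line"
    unfolding differentiable_on_def differentiable_def using D by blast
  ultimately show ?thesis
    using lipschitz_on_nonneg[OF M] by (simp add: lipschitz_hessian_def)
qed

text \<open>
  When \<open>\<phi>\<close> is known only through an implicit parametrization \<open>\<phi> (X s *\<^sub>R e) = F s\<close>, the chain rule
  gives \<open>\<phi>' \<cdot> X' = F'\<close>, so the slope of \<open>\<phi>\<close> is obtained without inverting \<open>X\<close>.
\<close>

lemma gradient_along_reparametrization:
  assumes \<phi>: "\<phi> differentiable (at (X t *\<^sub>R e) within line)"
    and X: "(X has_real_derivative X') (at t)" and F: "(F has_real_derivative F') (at t)"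
    and eq: "\<And>s. \<phi> (X s *\<^sub>R e) = F s" and "X' \<noteq> 0"
  shows "gradient_within line \<phi> (X t *\<^sub>R e) = (F' / X') *\<^sub>R e"
proof -
  obtain D where D: "(\<phi> has_derivative D) (at (X t *\<^sub>R e) within line)"
    using \<phi> by (auto simp: differentiable_def)
  have "((\<lambda>s. X s *\<^sub>R e) has_derivative (\<lambda>h. (X' * h) *\<^sub>R e)) (at t)"
    using X unfolding has_field_derivative_def by (rule has_derivative_scaleR_left)
  moreover have "(\<phi> has_derivative D) (at (X t *\<^sub>R e) within range (\<lambda>s. X s *\<^sub>R e))"
    by (rule has_derivative_subset[OF D]) auto
  ultimately have "((\<lambda>s. \<phi> (X s *\<^sub>R e)) has_derivative (\<lambda>h. D ((X' * h) *\<^sub>R e))) (at t)"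
    by (rule has_derivative_in_compose)
  then have "(F has_derivative (\<lambda>h. D ((X' * h) *\<^sub>R e))) (at t)"
    by (simp add: eq)
  from has_derivative_unique[OF this F[unfolded has_field_derivative_def]]
  have "D ((X' * 1) *\<^sub>R e) = F' * 1" by (rule fun_cong)
  then have "X' * D e = F'"
    using linear_scale[OF has_derivative_linear[OF D]] by simp
  then have "D e = F' / X'" using \<open>X' \<noteq> 0\<close> by (simp add: field_simps)
  then show ?thesis using gradient_on_line[OF _ D] by simp
qed

text \<open>
  On the line the equation \<open>z = x - \<alpha> \<nabla>f(z)\<close> reads \<open>s + \<alpha> F'(s) = x\<close>, so injectivity of the
  left-hand side makes the parameter of \<open>x\<close> its only solution.
\<close>

lemma inner_solution_ridge:
  assumes F: "\<And>t. (F has_real_derivative F' t) (at t)" and inj: "inj (\<lambda>t. t + \<alpha> * F' t)"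
  shows "inner_solution line (\<lambda>v. F (inner e v)) \<alpha> ((t + \<alpha> * F' t) *\<^sub>R e) = t *\<^sub>R e"
  unfolding inner_solution_def
proof (rule the_equality)
  show "t *\<^sub>R e \<in> line \<and> t *\<^sub>R e = (t + \<alpha> * F' t) *\<^sub>R e
      - \<alpha> *\<^sub>R gradient_within line (\<lambda>v. F (inner e v)) (t *\<^sub>R e)"
    by (simp add: gradient_ridge[OF F] scaleR_left_distrib)
next
  fix z assume z: "z \<in> line \<and> z = (t + \<alpha> * F' t) *\<^sub>R e
      - \<alpha> *\<^sub>R gradient_within line (\<lambda>v. F (inner e v)) z"
  then have "inner e z = inner e ((t + \<alpha> * F' t) *\<^sub>R e - \<alpha> *\<^sub>R (F' (inner e z) *\<^sub>R e))"
    by (metis gradient_ridge[OF F])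
  then have "inner e z + \<alpha> * F' (inner e z) = t + \<alpha> * F' t"
    by (simp add: inner_diff_right)
  then have "inner e z = t" using injD[OF inj] by blast
  then show "z = t *\<^sub>R e" using z scaleR_inner_line by metis
qed

end

section \<open>A quadratic with a cosine ripple\<close>

lemma abs_sin_diff_le: "\<bar>sin x - sin y\<bar> \<le> \<bar>x - y\<bar>" for x y :: real
proof -
  have "1-lipschitz_on UNIV (sin :: real \<Rightarrow> real)"
    by (rule bounded_derivative_imp_lipschitz[where f' = "\<lambda>t h. h * cos t"])
       (auto intro!: derivative_eq_intros onorm_le simp: abs_mult mult_left_le)
  from lipschitz_onD[OF this] show ?thesis by (simp add: dist_real_def)
qed

lemma lipschitz_one_plus_cos: "1-lipschitz_on UNIV (\<lambda>t::real. 1 + cos t)"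
proof (rule lipschitz_onI)
  fix x y :: real
  show "dist (1 + cos x) (1 + cos y) \<le> 1 * dist x y"
    using abs_sin_diff_le[of "x + pi/2" "y + pi/2"]
    by (simp add: sin_add dist_real_def)
qed simp

lemma lipschitz_plus_sin: "2-lipschitz_on UNIV (\<lambda>t::real. t + sin t)"
proof (rule lipschitz_onI)
  fix x y :: real
  show "dist (x + sin x) (y + sin y) \<le> 2 * dist x y"
    using abs_sin_diff_le[of x y] abs_triangle_ineq[of "x - y" "sin x - sin y"]
    by (simp add: dist_real_def algebra_simps)
qed simp

definition ripple :: "real \<Rightarrow> real"
  where "ripple t = t\<^sup>2 / 2 - cos t"

lemma ripple_deriv: "(ripple has_real_derivative t + sin t) (at t)"
  unfolding ripple_def by (auto intro!: derivative_eq_intros)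

lemma ripple_deriv2: "((\<lambda>t. t + sin t) has_real_derivative 1 + cos t) (at t)" for t :: real
  by (auto intro!: derivative_eq_intros)

lemma one_plus_cos_nonneg: "0 \<le> 1 + cos t" for t :: real
  using cos_ge_minus_one[of t] by linarith

lemma convex_ripple: "convex_on UNIV ripple"
  by (rule f''_ge0_imp_convex[OF _ ripple_deriv ripple_deriv2 one_plus_cos_nonneg]) simp_all

text \<open>
  The map \<open>t \<mapsto> t + \<alpha> (t + sin t)\<close> is the inverse of the proximal map \<open>x \<mapsto> z(x)\<close>.
\<close>

lemma inverse_prox_deriv:
  "((\<lambda>t. t + \<alpha> * (t + sin t)) has_real_derivative 1 + \<alpha> * (1 + cos t)) (at t)" for \<alpha> t :: real
  by (auto intro!: derivative_eq_intros)

lemma inverse_prox_inj: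
  fixes \<alpha> :: real
  assumes "\<alpha> > 0"
  shows "inj (\<lambda>t. t + \<alpha> * (t + sin t))"
proof -
  have "strict_mono (\<lambda>t. t + \<alpha> * (t + sin t))"
  proof (rule strict_monoI)
    fix a b :: real assume "a < b"
    have "\<exists>y. ((\<lambda>t. t + \<alpha> * (t + sin t)) has_real_derivative y) (at x) \<and> 0 < y" for x
      using inverse_prox_deriv[of \<alpha> x] one_plus_cos_nonneg[of x] assms
      by (intro exI[of _ "1 + \<alpha> * (1 + cos x)"]) (auto intro: add_pos_nonneg)
    then show "a + \<alpha> * (a + sin a) < b + \<alpha> * (b + sin b)"
      by (intro DERIV_pos_imp_increasing[OF \<open>a < b\<close>])
  qed
  then show ?thesis by (rule strict_mono_imp_inj_on)
qed

context unit_vector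
begin

lemma gradient_meta_objective:
  fixes t :: real
  assumes \<alpha>: "\<alpha> > 0"
    and diff: "imaml_objective line (\<lambda>v. ripple (inner e v)) \<alpha> differentiable_on line"
  shows "gradient_within line (imaml_objective line (\<lambda>v. ripple (inner e v)) \<alpha>)
      ((t + \<alpha> * (t + sin t)) *\<^sub>R e) = ((t + sin t) / (1 + \<alpha> * (1 + cos t))) *\<^sub>R e"
proof (rule gradient_along_reparametrization[where F = ripple, OF _ inverse_prox_deriv ripple_deriv])
  show "imaml_objective line (\<lambda>v. ripple (inner e v)) \<alpha> differentiable
      at ((t + \<alpha> * (t + sin t)) *\<^sub>R e) within line"
    using diff by (simp add: differentiable_on_def)
  show "imaml_objective line (\<lambda>v. ripple (inner e v)) \<alpha> ((s + \<alpha> * (s + sin s)) *\<^sub>R e) = ripple s" for s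
    using inner_solution_ridge[OF ripple_deriv inverse_prox_inj[OF \<alpha>]]
    by (simp add: imaml_objective_def)
  have "0 \<le> \<alpha> * (1 + cos t)" using \<alpha> one_plus_cos_nonneg by simp
  then show "1 + \<alpha> * (1 + cos t) \<noteq> 0" by linarith
qed

text \<open>
  Consecutive multiples \<open>2n\<pi>\<close> and \<open>(2n+1)\<pi>\<close> are sent by \<open>t \<mapsto> t + \<alpha> (t + sin t)\<close> to points at
  distance \<open>(1 + \<alpha>) \<pi>\<close>, independent of \<open>n\<close>, while the slopes there differ by more than
  \<open>2n\<pi> (1 - 1 / (1 + 2\<alpha>))\<close>.
\<close>

lemma meta_objective_not_smooth:
  assumes \<alpha>: "\<alpha> > 0"
  shows "\<not> L_smooth line L (imaml_objective line (\<lambda>v. ripple (inner e v)) \<alpha>)"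
proof
  let ?\<phi> = "imaml_objective line (\<lambda>v. ripple (inner e v)) \<alpha>"
  assume smooth: "L_smooth line L ?\<phi>"
  then have diff: "?\<phi> differentiable_on line"
    and lip: "L-lipschitz_on line (gradient_within line ?\<phi>)"
    by (auto simp: L_smooth_def)
  define q where "q = 1 - 1 / (1 + 2 * \<alpha>)"
  have "q > 0" using \<alpha> by (simp add: q_def)
  have bound: "real n * (2 * pi * q) \<le> L * ((1 + \<alpha>) * pi)" for n
  proof -
    define a where "a = 2 * real n * pi"
    have [simp]: "sin a = 0" "cos a = 1"
      using sin_2npi[of n] cos_2npi[of n] by (simp_all add: a_def)
    have "\<bar>a / (1 + \<alpha> * 2) - (a + pi)\<bar> \<le> L * \<bar>(a + \<alpha> * a) - (a + pi + \<alpha> * (a + pi))\<bar>"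
      using lipschitz_onD[OF lip, of "(a + \<alpha> * (a + sin a)) *\<^sub>R e"
          "(a + pi + \<alpha> * (a + pi + sin (a + pi))) *\<^sub>R e"]
      unfolding gradient_meta_objective[OF \<alpha> diff] by simp
    also have "(a + \<alpha> * a) - (a + pi + \<alpha> * (a + pi)) = - ((1 + \<alpha>) * pi)"
      by (simp add: algebra_simps)
    also have "\<bar>- ((1 + \<alpha>) * pi)\<bar> = (1 + \<alpha>) * pi"
      using \<alpha> by simp
    finally have "(a + pi) - a / (1 + \<alpha> * 2) \<le> L * ((1 + \<alpha>) * pi)"
      by linarith
    moreover have "a * q = a - a / (1 + \<alpha> * 2)"
      by (simp add: q_def algebra_simps)
    ultimately have "a * q \<le> L * ((1 + \<alpha>) * pi)" using pi_gt_zero by linarith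
    then show ?thesis by (simp add: a_def mult_ac)
  qed
  have "0 < 2 * pi * q" using \<open>q > 0\<close> by simp
  then obtain n where "L * ((1 + \<alpha>) * pi) < real n * (2 * pi * q)"
    using reals_Archimedean3 by blast
  with bound[of n] show False by linarith
qed

end

section \<open>The one-dimensional coordinate space\<close>

definition unit0 :: fsvec
  where "unit0 = Abs_fsvec (\<lambda>i. if i = 0 then 1 else 0)"

lemma coord_unit0: "coord unit0 i = (if i = 0 then 1 else 0)"
  by (simp add: unit0_def Abs_fsvec_inverse)

interpretation unit0: unit_vector unit0
proof
  have "unit0 \<in> Rd 1" by (simp add: Rd_def coord_unit0)
  from inner_Rd[OF this] show "inner unit0 unit0 = 1" by (simp add: coord_unit0)
qed

lemma Rd_1_eq_line: "Rd 1 = unit0.line"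
proof (intro set_eqI iffI)
  fix x assume "x \<in> Rd 1"
  then have "x = coord x 0 *\<^sub>R unit0"
    by (intro fsvec_eqI) (auto simp: Rd_def coord_unit0)
  then show "x \<in> unit0.line" unfolding unit0.line_def by (rule range_eqI)
qed (auto simp: unit0.line_def Rd_def coord_unit0)

theorem theorem2:
  shows "\<exists>d\<ge>1. \<exists>f :: fsvec \<Rightarrow> real.
    convex_on (Rd d) f \<and>
    (\<exists>L. L_smooth (Rd d) L f) \<and>
    (\<exists>M. lipschitz_hessian (Rd d) M f) \<and>
    (\<forall>\<alpha>>0. \<not> (\<exists>L. L_smooth (Rd d) L (imaml_objective (Rd d) f \<alpha>)))"
proof (intro exI conjI)
  let ?f = "\<lambda>v. ripple (inner unit0 v)"
  show "convex_on (Rd 1) ?f"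
    unfolding Rd_1_eq_line by (rule unit0.convex_on_ridge[OF convex_ripple])
  show "L_smooth (Rd 1) 2 ?f"
    unfolding Rd_1_eq_line by (rule unit0.L_smooth_ridge[OF ripple_deriv lipschitz_plus_sin])
  show "lipschitz_hessian (Rd 1) 1 ?f"
    unfolding Rd_1_eq_line
    by (rule unit0.lipschitz_hessian_ridge[OF ripple_deriv ripple_deriv2 lipschitz_one_plus_cos])
  show "\<forall>\<alpha>>0. \<not> (\<exists>L. L_smooth (Rd 1) L (imaml_objective (Rd 1) ?f \<alpha>))"
    unfolding Rd_1_eq_line using unit0.meta_objective_not_smooth by blast
qed simp

end
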